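(* Let $\rho:\mathbb{O}\to\mathbb{O}$ be the order-three octonion automorphism given by $\rho(e_k)=e_k$ for $k=0,1,3,7$ and $$\rho(e_2)=-\tfrac12(e_2-\sqrt3\,e_5),\quad \rho(e_5)=-\tfrac12(e_5+\sqrt3\,e_2),\quad \rho(e_4)=-\tfrac12(e_4-\sqrt3\,e_6),\quad \rho(e_6)=-\tfrac12(e_6+\sqrt3\,e_4),$$ and let $x*_\rho y=\rho(\overline{x})\cdot\rho^2(\overline{y})$. Then the Cayley--Graves order $L_C=\mathbb{Z}\{1,e_1,\dots,e_7\}$ is not stable under $\rho$, and the Coxeter--Dickson order $L_E$ is not closed under $*_\rho$, i.e. $L_E*_\rho L_E\not\subseteq L_E$.
   Context: Octonions: $\mathbb{O}$ is the real algebra with basis $e_0=1,e_1,\dots,e_7$, where $1$ is the unit, $e_k^2=-1$ for $k\ge 1$, $e_ie_j=-e_je_i$ for distinct $i,j\geq 1$, and $e_ie_j=e_k$ whenever $(i,j,k)$ is a cyclic permutation of one of the seven oriented triples $(1,2,4),(1,3,7),(2,3,6),(4,3,5),(6,1,5),(5,2,7),(7,4,6)$. Conjugation is $\overline{x_0+\sum_{k\ge1} x_ke_k}=x_0-\sum_{k\ge1} x_ke_k$. $L_E$ is the $\mathbb{Z}$-span of $1,e_1,e_2,e_3,h,e_1h,e_2h,e_3h$ with $h=\frac{e_1+e_2+e_3+e_4}{2}$. *)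

theory Defs
  imports "HOL-Analysis.Analysis"
begin

text \<open>
  Octonions are vectors over the eight-element index type \<open>8\<close>, whose elements are \<open>0, \<dots>, 7\<close>.
  The vector space structure is the library's; the product is written \<open>\<cdot>\<close>, because \<open>*\<close> on vectors
  is the componentwise product.
\<close>

type_synonym octonion = "real ^ 8"

definition e :: "8 \<Rightarrow> octonion" where
  "e k = axis k 1"

definition triples :: "(8 \<times> 8 \<times> 8) set" where
  "triples = {(1,2,4), (1,3,7), (2,3,6), (4,3,5), (6,1,5), (5,2,7), (7,4,6)}"

definition cyclic_triples :: "(8 \<times> 8 \<times> 8) set" where
  "cyclic_triples = {(i,j,k). (i,j,k) \<in> triples \<or> (j,k,i) \<in> triples \<or> (k,i,j) \<in> triples}"

text \<open>
  For distinct \<open>i, j \<noteq> 0\<close> exactly one summand below is nonzero: every such pair lies on exactly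
  one of the seven lines, in one of the two orientations.
\<close>

definition basis_mult :: "8 \<Rightarrow> 8 \<Rightarrow> octonion" where
  "basis_mult i j =
     (if i = 0 then e j
      else if j = 0 then e i
      else if i = j then - e 0
      else (\<Sum>k\<in>UNIV. if (i,j,k) \<in> cyclic_triples then e k
                    else if (j,i,k) \<in> cyclic_triples then - e k
                    else 0))"

definition oct_mult :: "octonion \<Rightarrow> octonion \<Rightarrow> octonion"  (infixl "\<cdot>" 70) where
  "x \<cdot> y = (\<Sum>i\<in>UNIV. \<Sum>j\<in>UNIV. (x $ i * y $ j) *\<^sub>R basis_mult i j)"

lemma e_nth: "e j $ i = (if i = j then 1 else 0)"
  by (simp add: e_def axis_def)

lemma e_mult: "e i \<cdot> e j = basis_mult i j"
  unfolding oct_mult_def e_nth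
  by (simp add: if_distrib[of "\<lambda>c. c * _"] if_distrib[of "\<lambda>c. c *\<^sub>R _"]
      if_distrib[of "\<lambda>c. _ * c"] cong: if_cong)

definition oct_conj :: "octonion \<Rightarrow> octonion" where
  "oct_conj x = (\<chi> k. if k = 0 then x $ k else - (x $ k))"

definition oct_automorphism :: "(octonion \<Rightarrow> octonion) \<Rightarrow> bool" where
  "oct_automorphism f \<longleftrightarrow> linear f \<and> bij f \<and> (\<forall>x y. f (x \<cdot> y) = f x \<cdot> f y)"

definition rho_basis :: "8 \<Rightarrow> octonion" where
  "rho_basis k =
     (if k = 2 then - (1/2) *\<^sub>R (e 2 - sqrt 3 *\<^sub>R e 5)
      else if k = 5 then - (1/2) *\<^sub>R (e 5 + sqrt 3 *\<^sub>R e 2)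
      else if k = 4 then - (1/2) *\<^sub>R (e 4 - sqrt 3 *\<^sub>R e 6)
      else if k = 6 then - (1/2) *\<^sub>R (e 6 + sqrt 3 *\<^sub>R e 4)
      else e k)"

definition rho :: "octonion \<Rightarrow> octonion" where
  "rho x = (\<Sum>k\<in>UNIV. x $ k *\<^sub>R rho_basis k)"

lemma rho_e: "rho (e k) = rho_basis k"
  by (simp add: rho_def e_nth if_distrib[of "\<lambda>c. c *\<^sub>R _"] cong: if_cong)

definition star_rho :: "octonion \<Rightarrow> octonion \<Rightarrow> octonion"  (infixl "\<star>" 70) where
  "x \<star> y = rho (oct_conj x) \<cdot> rho (rho (oct_conj y))"

interpretation int_module: module "\<lambda>(n::int) (x::octonion). of_int n *\<^sub>R x"
  by unfold_locales (simp_all add: scaleR_add_right scaleR_add_left)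

abbreviation int_span :: "octonion set \<Rightarrow> octonion set" where
  "int_span \<equiv> int_module.span"

definition h :: octonion where
  "h = (1/2) *\<^sub>R (e 1 + e 2 + e 3 + e 4)"

definition L_C :: "octonion set" where
  "L_C = int_span {e 0, e 1, e 2, e 3, e 4, e 5, e 6, e 7}"

definition L_E :: "octonion set" where
  "L_E = int_span {e 0, e 1, e 2, e 3, h, e 1 \<cdot> h, e 2 \<cdot> h, e 3 \<cdot> h}"

end

theory Submission
  imports Defs
begin

text \<open>
  Two denominators decide the negative claims. Coordinates of \<open>L_C\<close> are integers, but \<open>rho (e 2)\<close>
  has a coordinate \<open>-1/2\<close>. Coordinates of \<open>L_E\<close> are half-integers, but
  \<open>e 0 \<star> e 2 = - rho (rho (e 2))\<close> has a coordinate \<open>sqrt 3 / 2\<close>.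
\<close>

lemma UNIV_8: "(UNIV :: 8 set) = {0, 1, 2, 3, 4, 5, 6, 7}"
proof -
  have "card {0, 1, 2, 3, 4, 5, 6, 7 :: 8} = CARD(8)"
    by simp
  then show ?thesis
    by (intro card_subset_eq[symmetric] finite subset_UNIV)
qed

lemma sum_8: "sum f (UNIV :: 8 set) = f 0 + f 1 + f 2 + f 3 + f 4 + f 5 + f 6 + f 7"
  for f :: "8 \<Rightarrow> 'a::comm_monoid_add"
  unfolding UNIV_8 by (simp add: add.assoc)

lemma forall_8: "(\<forall>k :: 8. P k) \<longleftrightarrow> P 0 \<and> P 1 \<and> P 2 \<and> P 3 \<and> P 4 \<and> P 5 \<and> P 6 \<and> P 7"
proof -
  have "(\<forall>k. P k) \<longleftrightarrow> (\<forall>k\<in>UNIV. P k)"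
    by simp
  then show ?thesis
    unfolding UNIV_8 by simp
qed

text \<open>Only the summand at \<open>k\<close> can have a nonzero \<open>k\<close>-th coordinate,
  so the sum collapses. What remains are membership tests in a finite set, which simplification
  decides for numerals.\<close>

lemma basis_mult_nth:
  "basis_mult i j $ k =
     (if i = 0 then e j $ k
      else if j = 0 then e i $ k
      else if i = j then - e 0 $ k
      else if (i,j,k) \<in> cyclic_triples then 1
      else if (j,i,k) \<in> cyclic_triples then - 1
      else 0)"
proof -
  have "(\<Sum>l\<in>UNIV. if (i,j,l) \<in> cyclic_triples then e l
                    else if (j,i,l) \<in> cyclic_triples then - e l else 0) $ k
      = (\<Sum>l\<in>UNIV. if l = k then (if (i,j,k) \<in> cyclic_triples then 1
                    else if (j,i,k) \<in> cyclic_triples then - 1 else 0) else (0::real))"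
    unfolding sum_component by (intro sum.cong) (auto simp: e_nth)
  then show ?thesis
    by (simp add: basis_mult_def)
qed

lemma oct_mult_nth:
  "(x \<cdot> y) $ 0 = x$0*y$0 - x$1*y$1 - x$2*y$2 - x$3*y$3 - x$4*y$4 - x$5*y$5 - x$6*y$6 - x$7*y$7"
  "(x \<cdot> y) $ 1 = x$0*y$1 + x$1*y$0 + x$2*y$4 - x$4*y$2 + x$3*y$7 - x$7*y$3 + x$5*y$6 - x$6*y$5"
  "(x \<cdot> y) $ 2 = x$0*y$2 + x$2*y$0 + x$4*y$1 - x$1*y$4 + x$3*y$6 - x$6*y$3 + x$7*y$5 - x$5*y$7"
  "(x \<cdot> y) $ 3 = x$0*y$3 + x$3*y$0 + x$7*y$1 - x$1*y$7 + x$6*y$2 - x$2*y$6 + x$5*y$4 - x$4*y$5"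
  "(x \<cdot> y) $ 4 = x$0*y$4 + x$4*y$0 + x$1*y$2 - x$2*y$1 + x$3*y$5 - x$5*y$3 + x$6*y$7 - x$7*y$6"
  "(x \<cdot> y) $ 5 = x$0*y$5 + x$5*y$0 + x$4*y$3 - x$3*y$4 + x$6*y$1 - x$1*y$6 + x$2*y$7 - x$7*y$2"
  "(x \<cdot> y) $ 6 = x$0*y$6 + x$6*y$0 + x$2*y$3 - x$3*y$2 + x$1*y$5 - x$5*y$1 + x$7*y$4 - x$4*y$7"
  "(x \<cdot> y) $ 7 = x$0*y$7 + x$7*y$0 + x$1*y$3 - x$3*y$1 + x$5*y$2 - x$2*y$5 + x$4*y$6 - x$6*y$4"
  by (simp_all add: oct_mult_def sum_8 basis_mult_nth e_nth cyclic_triples_def triples_def)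

text \<open>Geometrically, this is a turn by 120 degrees in the plane of \<open>e 2\<close>,
  \<open>e 5\<close> and in that of \<open>e 4\<close>, \<open>e 6\<close>; the other four axes are
  fixed.\<close>

lemma rho_nth:
  "rho x $ 0 = x$0"
  "rho x $ 1 = x$1"
  "rho x $ 2 = - (x$2 + sqrt 3 * x$5) / 2"
  "rho x $ 3 = x$3"
  "rho x $ 4 = - (x$4 + sqrt 3 * x$6) / 2"
  "rho x $ 5 = (sqrt 3 * x$2 - x$5) / 2"
  "rho x $ 6 = (sqrt 3 * x$4 - x$6) / 2"
  "rho x $ 7 = x$7"
  by (simp_all add: rho_def sum_8 rho_basis_def e_nth field_simps)

text \<open>The products are nested to the right so that the rule also fires inside longer
  monomials.\<close>

lemma sqrt_3_mult: "sqrt 3 * (sqrt 3 * x) = 3 * x"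
  by (simp flip: mult.assoc)

text \<open>Each coordinate is a polynomial identity in the sixteen coordinates of \<open>x\<close>
  and \<open>y\<close>. Beyond field arithmetic it rests only on the square of \<open>sqrt 3\<close>
  being 3.\<close>

lemma rho_oct_mult: "rho (x \<cdot> y) = rho x \<cdot> rho y"
  unfolding vec_eq_iff forall_8 rho_nth oct_mult_nth
  by (intro conjI; simp add: field_simps sqrt_3_mult)

lemma linear_rho: "linear rho"
  by (rule linearI) (simp_all add: vec_eq_iff forall_8 rho_nth field_simps)

text \<open>Three turns by 120 degrees make a full turn in each of the two planes.\<close>

lemma rho_cubed: "rho (rho (rho x)) = x"
  by (simp add: vec_eq_iff forall_8 rho_nth field_simps sqrt_3_mult)

lemma oct_automorphism_rho: "oct_automorphism rho"
proof -
  have "bij rho"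
    by (rule o_bij[of "rho \<circ> rho"]) (simp_all add: fun_eq_iff rho_cubed)
  then show ?thesis
    by (simp add: oct_automorphism_def linear_rho rho_oct_mult)
qed

lemma sqrt_3_not_Ints: "sqrt 3 \<notin> \<int>"
proof
  assume "sqrt 3 \<in> \<int>"
  then obtain n where n: "sqrt 3 = of_int n"
    by (auto elim: Ints_cases)
  have "1 < sqrt 3" "sqrt 3 < 2"
    by (simp_all add: real_less_lsqrt)
  then show False
    unfolding n by simp
qed

text \<open>The constant \<open>c\<close> is a common denominator of the generators; integer
  combinations cannot enlarge it. It is 1 for \<open>L_C\<close> and 2 for
  \<open>L_E\<close>.\<close>

lemma int_span_coords:
  assumes "\<And>b k. b \<in> B \<Longrightarrow> c * b $ k \<in> \<int>" and "x \<in> int_span B"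
  shows "c * x $ k \<in> \<int>"
  using assms(2)
proof (induction rule: int_module.span_induct_alt)
  case base
  show ?case by simp
next
  case (step n b y)
  have "c * (of_int n *\<^sub>R b + y) $ k = of_int n * (c * b $ k) + c * y $ k"
    by (simp add: algebra_simps)
  with step assms(1) show ?case
    by simp
qed

lemma L_C_coords: "x \<in> L_C \<Longrightarrow> x $ k \<in> \<int>"
  unfolding L_C_def
  by (rule int_span_coords[where c = 1, simplified]) (auto simp: e_nth)

text \<open>Left multiplication by \<open>e i\<close> permutes coordinates up to sign, so
  \<open>e i \<cdot> h\<close> needs no larger denominator than \<open>h\<close>.\<close>

lemma L_E_coords:
  assumes "x \<in> L_E"
  shows "2 * x $ k \<in> \<int>"
proof (rule int_span_coords[OF _ assms[unfolded L_E_def]])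
  fix b k
  assume "b \<in> {e 0, e 1, e 2, e 3, h, e 1 \<cdot> h, e 2 \<cdot> h, e 3 \<cdot> h}"
  moreover have "\<forall>b\<in>{e 0, e 1, e 2, e 3, h, e 1 \<cdot> h, e 2 \<cdot> h, e 3 \<cdot> h}. \<forall>k. 2 * b $ k \<in> \<int>"
    by (simp add: forall_8 oct_mult_nth h_def e_nth)
  ultimately show "2 * b $ k \<in> \<int>"
    by blast
qed

theorem mainTheorem5:
  shows "oct_automorphism rho
    \<and> rho ^^ 3 = id \<and> (\<forall>n. 0 < n \<and> n < 3 \<longrightarrow> rho ^^ n \<noteq> id)
    \<and> \<not> rho ` L_C \<subseteq> L_C
    \<and> \<not> (\<forall>x\<in>L_E. \<forall>y\<in>L_E. x \<star> y \<in> L_E)"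
proof (intro conjI allI impI)
  show "oct_automorphism rho"
    by (rule oct_automorphism_rho)
  show "rho ^^ 3 = id"
    by (simp add: fun_eq_iff numeral_3_eq_3 rho_cubed)
next
  fix n :: nat
  assume "0 < n \<and> n < 3"
  then have "n = 1 \<or> n = 2"
    by auto
  \<comment> \<open>Both left-hand coordinates are -1/2, the cosine of 120 and of 240
    degrees.\<close>
  moreover have "rho (e 2) $ 2 \<noteq> e 2 $ 2" "rho (rho (e 2)) $ 2 \<noteq> e 2 $ 2"
    by (simp_all add: rho_nth e_nth)
  ultimately have "(rho ^^ n) (e 2) \<noteq> id (e 2)"
    by (auto simp: numeral_2_eq_2)
  then show "rho ^^ n \<noteq> id"
    by metis
next
  have "e 2 \<in> L_C"
    unfolding L_C_def by (rule int_module.span_base) simp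
  moreover have "rho (e 2) \<notin> L_C"
  proof
    assume "rho (e 2) \<in> L_C"
    from L_C_coords[OF this, of 2] have "(1/2 :: real) \<in> \<int>"
      by (simp add: rho_nth e_nth)
    then show False
      by (auto elim!: Ints_cases)
  qed
  ultimately show "\<not> rho ` L_C \<subseteq> L_C"
    by blast
next
  have "e 0 \<in> L_E" "e 2 \<in> L_E"
    unfolding L_E_def by (rule int_module.span_base; simp)+
  moreover have "e 0 \<star> e 2 \<notin> L_E"
  proof
    assume "e 0 \<star> e 2 \<in> L_E"
    \<comment> \<open>The left factor becomes the unit. Conjugation negates \<open>e 2\<close>, and
      the turn by 240 degrees has sine \<open>- sqrt 3 / 2\<close>; the signs cancel and doubling
      leaves \<open>sqrt 3\<close>.\<close>
    from L_E_coords[OF this, of 5] have "sqrt 3 \<in> \<int>"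
      by (simp add: star_rho_def oct_mult_nth rho_nth oct_conj_def e_nth)
    with sqrt_3_not_Ints show False ..
  qed
  ultimately show "\<not> (\<forall>x\<in>L_E. \<forall>y\<in>L_E. x \<star> y \<in> L_E)"
    by blast
qed

end
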